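(* Let $p>1$ and $u_0\in X$. For any $T>0$, the problem $$\begin{cases}u_t-\Delta u=|\nabla u|^p,& x\in H,\ t\in(0,T),\\ u=0,& x\in\partial H,\ t\in(0,T),\\ u(x,0)=u_0(x),& x\in H,\end{cases}$$ admits at most one solution in $Y_T$.
   Context: $H:=\mathbb{R}^n_+=\{x=(x',x_n)\in\mathbb{R}^{n-1}\times\mathbb{R}:\ x_n>0\}$, and $Q_T:=H\times(0,T)$ for $T>0$. Put $\beta=1/(p-1)$. For $r>0$, $\Gamma_r:=\{x\in\mathbb{R}^n:\ 0<x_n<r\}$. Let $w(x)=(1+x_n)^{\beta+1}$. A solution of the initial-boundary value problem on $(0,T)$ is a function $u\in C^{2,1}(Q_T)\cap C(\overline H\times[0,T))$ satisfying the problem in the classical sense. $C^0_{\mathcal U}(\overline H)=\{v\in C(\overline H):\ v\ge0,\ \sup_{\Gamma_r}v\to0 \text{ as } r\to0\}$; $L^\infty_w(H)=\{v\in L^\infty_{loc}(\overline H):\ v\ge0,\ \sup_H (v/w)<\infty\}$. $C^0_{\mathcal U}(\overline Q_T)$ and $L^\infty_w(Q_T)$ are defined in the same way with $H$, $\Gamma_r$ replaced by $Q_T$, $\Gamma_r\times(0,T)$ respectively. $Y_T:=C^0_{\mathcal U}(\overline Q_T)\cap L^\infty_w(Q_T)\cap C^{2,1}(Q_T)$ and $X:=C^0_{\mathcal U}(\overline H)\cap L^\infty_w(H)$. *)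

theory Defs
  imports "HOL-Analysis.Analysis" "HOL-Probability.Essential_Supremum"
begin

(* Points of R^n are vectors of type real^'n, n = CARD('n) >= 1. The coordinate called x_n in
   "x = (x', x_n)" is x $ k, where k :: 'n is an arbitrary fixed index: a type of class finite
   carries no order that would single out a last one. Space-time points are pairs (x, t). *)

definition half_space :: "'n::finite \<Rightarrow> (real^'n) set" where
  "half_space k = {x. x $ k > 0}"

definition strip :: "'n::finite \<Rightarrow> real \<Rightarrow> (real^'n) set" where
  "strip k r = {x. 0 < x $ k \<and> x $ k < r}"

definition cylinder :: "'n::finite \<Rightarrow> real \<Rightarrow> ((real^'n) \<times> real) set" where
  "cylinder k T = half_space k \<times> {0<..<T}"

definition weight :: "'n::finite \<Rightarrow> real \<Rightarrow> real^'n \<Rightarrow> real" where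
  "weight k p x = (1 + x $ k) powr (1 / (p - 1) + 1)"

text \<open>Function spaces. A function on the closure of an open set \<open>A\<close> is represented by a total
  function whose values outside \<open>closure A\<close> are irrelevant.\<close>

(* S r plays the role of the strip of width r near the boundary. The supremum is taken in the
   extended reals, since v need not be bounded on S r for a given r. *)
definition C0U :: "'a::euclidean_space set \<Rightarrow> (real \<Rightarrow> 'a set) \<Rightarrow> ('a \<Rightarrow> real) set" where
  "C0U A S = {v. continuous_on (closure A) v \<and> (\<forall>z\<in>closure A. v z \<ge> 0) \<and>
     ((\<lambda>r. SUP z\<in>S r. ereal (v z)) \<longlongrightarrow> 0) (at_right 0)}"

(* Locally bounded up to the boundary: essentially bounded on compact subsets of the closure of A. *)
definition Linf_loc_closure :: "'a::euclidean_space set \<Rightarrow> ('a \<Rightarrow> real) set" where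
  "Linf_loc_closure A = {v. v \<in> borel_measurable (lebesgue_on A) \<and>
     (\<forall>K. compact K \<and> K \<subseteq> closure A \<longrightarrow>
        (\<exists>C. AE z in lebesgue_on A. z \<in> K \<longrightarrow> \<bar>v z\<bar> \<le> C))}"

(* As usual for L^infinity spaces, "v >= 0" is meant almost everywhere and the supremum of v/w
   is the essential one. *)
definition Linf_weighted :: "'a::euclidean_space set \<Rightarrow> ('a \<Rightarrow> real) \<Rightarrow> ('a \<Rightarrow> real) set" where
  "Linf_weighted A w = {v \<in> Linf_loc_closure A.
     (AE z in lebesgue_on A. v z \<ge> 0) \<and>
     esssup (lebesgue_on A) (\<lambda>z. ereal (v z / w z)) < \<infinity>}"

text \<open>Classical partial derivatives, obtained as derivatives along a fixed direction \<open>e\<close>.\<close>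

definition has_dir_deriv :: "'a::euclidean_space \<Rightarrow> ('a \<Rightarrow> real) \<Rightarrow> 'a \<Rightarrow> bool" where
  "has_dir_deriv e f z \<longleftrightarrow> (\<lambda>s::real. f (z + s *\<^sub>R e)) field_differentiable (at 0)"

definition dir_deriv :: "'a::euclidean_space \<Rightarrow> ('a \<Rightarrow> real) \<Rightarrow> 'a \<Rightarrow> real" where
  "dir_deriv e f z = deriv (\<lambda>s::real. f (z + s *\<^sub>R e)) 0"

definition cont_dir_diff_on ::
    "'a::euclidean_space set \<Rightarrow> 'a \<Rightarrow> ('a \<Rightarrow> real) \<Rightarrow> bool" where
  "cont_dir_diff_on Q e f \<longleftrightarrow>
     (\<forall>z\<in>Q. has_dir_deriv e f z) \<and> continuous_on Q (dir_deriv e f)"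

abbreviation space_dir :: "'n::finite \<Rightarrow> (real^'n) \<times> real" where
  "space_dir i \<equiv> (axis i 1, 0)"

abbreviation time_dir :: "(real^'n::finite) \<times> real" where
  "time_dir \<equiv> (0, 1)"

definition C21 :: "((real^'n::finite) \<times> real) set \<Rightarrow> ((real^'n) \<times> real \<Rightarrow> real) set" where
  "C21 Q = {u. continuous_on Q u \<and> cont_dir_diff_on Q time_dir u \<and>
     (\<forall>i. cont_dir_diff_on Q (space_dir i) u) \<and>
     (\<forall>i j. cont_dir_diff_on Q (space_dir j) (dir_deriv (space_dir i) u))}"

definition time_deriv :: "((real^'n::finite) \<times> real \<Rightarrow> real) \<Rightarrow> (real^'n) \<times> real \<Rightarrow> real" where
  "time_deriv u z = dir_deriv time_dir u z"

definition space_grad :: "((real^'n::finite) \<times> real \<Rightarrow> real) \<Rightarrow> (real^'n) \<times> real \<Rightarrow> real^'n" where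
  "space_grad u z = (\<chi> i. dir_deriv (space_dir i) u z)"

definition space_laplacian :: "((real^'n::finite) \<times> real \<Rightarrow> real) \<Rightarrow> (real^'n) \<times> real \<Rightarrow> real" where
  "space_laplacian u z = (\<Sum>i\<in>UNIV. dir_deriv (space_dir i) (dir_deriv (space_dir i) u) z)"

definition X_space :: "'n::finite \<Rightarrow> real \<Rightarrow> (real^'n \<Rightarrow> real) set" where
  "X_space k p = C0U (half_space k) (strip k) \<inter> Linf_weighted (half_space k) (weight k p)"

definition Y_space :: "'n::finite \<Rightarrow> real \<Rightarrow> real \<Rightarrow> ((real^'n) \<times> real \<Rightarrow> real) set" where
  "Y_space k p T = C0U (cylinder k T) (\<lambda>r. strip k r \<times> {0<..<T}) \<inter>
     Linf_weighted (cylinder k T) (\<lambda>(x, t). weight k p x) \<inter> C21 (cylinder k T)"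

definition is_solution ::
    "'n::finite \<Rightarrow> real \<Rightarrow> real \<Rightarrow> (real^'n \<Rightarrow> real) \<Rightarrow> ((real^'n) \<times> real \<Rightarrow> real) \<Rightarrow> bool" where
  "is_solution k p T u0 u \<longleftrightarrow>
     u \<in> C21 (cylinder k T) \<and>
     continuous_on (closure (half_space k) \<times> {0..<T}) u \<and>
     (\<forall>x\<in>half_space k. \<forall>t\<in>{0<..<T}.
        time_deriv u (x, t) - space_laplacian u (x, t) = norm (space_grad u (x, t)) powr p) \<and>
     (\<forall>x\<in>frontier (half_space k). \<forall>t\<in>{0<..<T}. u (x, t) = 0) \<and>
     (\<forall>x\<in>half_space k. u (x, 0) = u0 x)"

end

theory Submission
  imports Defs
begin

text \<open>Let \<open>0 < m < 1\<close>. Convexity of the nonlinearity makes \<open>z = (v - m u) / (1 - m)\<close> a subsolution with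
  the same initial values as \<open>v\<close>, so it suffices to bound \<open>z\<close> uniformly in \<open>m\<close> and to let \<open>m\<close> tend
  to 1. The growth exponent \<open>q = p / (p - 1)\<close> is the critical one: since \<open>(q - 1) p = q\<close>, a multiple of
  \<open>x\<^sub>n powr q\<close> whose coefficient grows in time is a supersolution for a short time. By convexity again,
  supersolutions are closed under convex combinations, so a barrier depending only on the common
  growth bound of \<open>u\<close> and \<open>v\<close> can be averaged with two others that control infinity and then vanish
  in a limit. Their admissible time step shrinks as \<open>m\<close> tends to 1, but they leave no trace, so
  iterating the step for fixed \<open>m\<close> costs nothing.\<close>

section \<open>Convexity of the nonlinearity and calculus at a maximum\<close>

text \<open>The function \<open>x powr p\<close> is increasing and convex for nonnegative
  \<open>x\<close>, so it can be applied to the triangle inequality of the norm.\<close>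

lemma norm_powr_convex:
  fixes a b :: "'a::real_normed_vector" and p m :: real
  assumes "p > 1" "0 \<le> m" "m \<le> 1"
  shows "norm (m *\<^sub>R a + (1 - m) *\<^sub>R b) powr p \<le> m * norm a powr p + (1 - m) * norm b powr p"
proof -
  have scale: "(m * x) powr p \<le> m * x powr p" if "0 \<le> m" "m \<le> 1" "0 \<le> x" for m x :: real
  proof -
    have "m powr p \<le> m"
      using powr_mono'[of 1 p m] that assms(1) by (cases "m = 0") auto
    then show ?thesis
      using that by (simp add: powr_mult mult_right_mono)
  qed
  have conv: "(m * x + (1 - m) * y) powr p \<le> m * x powr p + (1 - m) * y powr p"
    if "0 \<le> x" "0 \<le> y" for x y :: real
  \<comment> \<open>A zero argument is left to \<open>scale\<close>, which rests on
    \<open>m powr p \<le> m\<close>; positive arguments use the convexity of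
    \<open>powr\<close>.\<close>
  proof (cases "x = 0 \<or> y = 0")
    case True
    then show ?thesis
      using scale[of m x] scale[of "1 - m" y] assms that by auto
  next
    case False
    then have "x > 0" "y > 0" using that by auto
    then show ?thesis
      using convex_onD[OF powr_convex, of p "1 - m" x y] assms by (simp add: algebra_simps)
  qed
  have "norm (m *\<^sub>R a + (1 - m) *\<^sub>R b) \<le> m * norm a + (1 - m) * norm b"
    using norm_triangle_ineq[of "m *\<^sub>R a" "(1 - m) *\<^sub>R b"] assms by simp
  then have "norm (m *\<^sub>R a + (1 - m) *\<^sub>R b) powr p \<le> (m * norm a + (1 - m) * norm b) powr p"
    using assms by (intro powr_mono2) auto
  with conv[of "norm a" "norm b"] show ?thesis by simp
qed

text \<open>Only values to the left are compared, because in \<open>comparison\<close> the maximum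
  may sit at the final time.\<close>

lemma deriv_nonneg_at_left_max:
  fixes f :: "real \<Rightarrow> real"
  assumes "DERIV f x :> l" "d > 0" "\<And>h. 0 < h \<Longrightarrow> h < d \<Longrightarrow> f (x - h) \<le> f x"
  shows "l \<ge> 0"
proof (rule ccontr)
  assume "\<not> l \<ge> 0"
  then obtain e where e: "e > 0" "\<And>h. h > 0 \<Longrightarrow> h < e \<Longrightarrow> f x < f (x - h)"
    using DERIV_neg_dec_left[OF assms(1)] by (auto simp: not_le)
  define h where "h = min d e / 2"
  have "0 < h" "h < d" "h < e" using assms(2) e(1) by (auto simp: h_def)
  then show False using e(2)[of h] assms(3)[of h] by simp
qed

text \<open>If \<open>l\<close> were positive, \<open>f'\<close> would be positive just to the right
  of its zero \<open>x\<close>, and \<open>f\<close> would increase there beyond its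
  maximum.\<close>

lemma second_derivative_test:
  fixes f f' :: "real \<Rightarrow> real"
  assumes "d > 0" and der: "\<And>s. \<bar>s - x\<bar> < d \<Longrightarrow> DERIV f s :> f' s"
    and der2: "DERIV f' x :> l" and max: "\<And>s. \<bar>s - x\<bar> < d \<Longrightarrow> f s \<le> f x"
  shows "f' x = 0" "l \<le> 0"
proof -
  show zero: "f' x = 0"
    using assms by (intro DERIV_local_max[of f "f' x" x d]) (auto simp: abs_minus_commute)
  show "l \<le> 0"
  proof (rule ccontr)
    assume "\<not> l \<le> 0"
    then obtain e where e: "e > 0" "\<And>h. h > 0 \<Longrightarrow> h < e \<Longrightarrow> f' x < f' (x + h)"
      using DERIV_pos_inc_right[OF der2] by (auto simp: not_le)
    define h where "h = min d e / 2"
    have h: "0 < h" "h < d" "h < e" using assms(1) e(1) by (auto simp: h_def)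
    have "f x < f (x + h)"
    proof (rule DERIV_pos_imp_increasing_open[where f = f and a = x and b = "x + h"])
      show "x < x + h" using h by simp
      show "\<exists>y. DERIV f s :> y \<and> y > 0" if "x < s" "s < x + h" for s
        using der[of s] e(2)[of "s - x"] that h zero by (intro exI[of _ "f' s"]) auto
      show "continuous_on {x..x + h} f"
        using der h by (intro continuous_at_imp_continuous_on) (force intro!: DERIV_isCont[OF der])
    qed
    with max[of "x + h"] h show False by simp
  qed
qed

text \<open>Openness of \<open>Q\<close> leaves an interval of the line through \<open>z\<close>
  along \<open>e\<close>, where the one-variable test applies. Only competitors on that line
  matter.\<close>

lemma directional_max:
  fixes f f' :: "'a::real_normed_vector \<Rightarrow> real"
  assumes "open Q" "z \<in> Q"
    and der: "\<And>y. y \<in> Q \<Longrightarrow> DERIV (\<lambda>s. f (y + s *\<^sub>R e)) 0 :> f' y"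
    and der2: "DERIV (\<lambda>s. f' (z + s *\<^sub>R e)) 0 :> l"
    and max: "\<And>s. z + s *\<^sub>R e \<in> Q \<Longrightarrow> f (z + s *\<^sub>R e) \<le> f z"
  shows "f' z = 0" "l \<le> 0"
proof -
  have "open ((\<lambda>s. z + s *\<^sub>R e) -` Q)"
    using assms(1) by (intro open_vimage continuous_intros)
  then obtain d where d: "d > 0" "\<And>s. \<bar>s\<bar> < d \<Longrightarrow> z + s *\<^sub>R e \<in> Q"
    using assms(2) by (auto simp: open_dist dist_real_def dest!: bspec[of _ _ "0::real"])
  have "DERIV (\<lambda>s. f (z + s *\<^sub>R e)) s :> f' (z + s *\<^sub>R e)" if "\<bar>s - 0\<bar> < d" for s
  proof -
    have "DERIV (\<lambda>r. f (z + (r + s) *\<^sub>R e)) 0 :> f' (z + s *\<^sub>R e)"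
      using der[OF d(2), of s] that by (simp add: algebra_simps)
    then show ?thesis
      using DERIV_shift[of "\<lambda>s. f (z + s *\<^sub>R e)" _ 0 s] by simp
  qed
  from second_derivative_test[OF d(1) this der2] d max
  show "f' z = 0" "l \<le> 0" by auto
qed

text \<open>A step length that does not shrink reaches \<open>b\<close> after finitely many steps.
  It serves twice: inside \<open>ordered_for_short_time\<close> for fixed \<open>m\<close>, and for
  uniqueness itself.\<close>

lemma time_stepping:
  fixes P :: "real \<Rightarrow> bool"
  assumes "\<tau> > 0" "P a" "a \<le> b"
    and step: "\<And>s t. a \<le> s \<Longrightarrow> s \<le> t \<Longrightarrow> t \<le> b \<Longrightarrow> t \<le> s + \<tau> \<Longrightarrow> P s \<Longrightarrow> P t"
  shows "P b"
proof -
  \<comment> \<open>Capping at \<open>b\<close> keeps all intermediate times in the interval, so the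
    last step may be shorter than \<tau>.\<close>
  have "P (min b (a + real n * \<tau>))" for n
  proof (induction n)
    case 0
    then show ?case using assms by simp
  next
    case (Suc n)
    show ?case
      by (rule step[OF _ _ _ _ Suc]) (use assms in \<open>auto simp: algebra_simps min_def\<close>)
  qed
  moreover obtain n where "(b - a) / \<tau> \<le> real n" using real_arch_simple by blast
  then have "min b (a + real n * \<tau>) = b"
    using assms(1) by (simp add: field_simps min_def)
  ultimately show ?thesis by metis
qed

section \<open>Softplus profiles and their derivatives\<close>

text \<open>The powers of the softplus function serve as profiles in place of \<open>max 0 y powr q\<close>:
  unlike the latter they are smooth, and their second derivative is dominated by the profile
  itself, which lets a coefficient growing in time absorb the Laplacian.\<close>

definition softplus :: "real \<Rightarrow> real" where
  "softplus y = ln (1 + exp y)"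

definition logistic :: "real \<Rightarrow> real" where
  "logistic y = exp y / (1 + exp y)"

lemma softplus_pos: "softplus y > 0"
  by (simp add: softplus_def ln_gt_zero add_pos_pos)

lemma softplus_ge: "y \<le> softplus y"
  using ln_mono[of "exp y" "1 + exp y"] by (simp add: softplus_def add_pos_pos)

lemma logistic_bounds: "0 < logistic y" "logistic y \<le> 1" "logistic y \<le> softplus y"
proof -
  show "0 < logistic y" "logistic y \<le> 1"
    by (simp_all add: logistic_def add_pos_pos field_simps)
  have pos: "0 < 1 + exp y" by (simp add: add_pos_pos)
  \<comment> \<open>This is \<open>ln x \<le> x - 1\<close> at \<open>x = 1 / (1 + exp y)\<close>,
    whose logarithm is \<open>- softplus y\<close>.\<close>
  then have "ln (1 / (1 + exp y)) \<le> 1 / (1 + exp y) - 1"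
    by (intro ln_le_minus_one) simp
  then have "- ln (1 + exp y) \<le> 1 / (1 + exp y) - 1"
    using pos by (simp add: ln_div)
  moreover have "1 / (1 + exp y) - 1 = - logistic y"
    using pos by (simp add: logistic_def field_simps)
  ultimately show "logistic y \<le> softplus y"
    by (simp add: softplus_def)
qed

lemma DERIV_softplus: "DERIV softplus y :> logistic y"
  unfolding softplus_def[abs_def] logistic_def
  by (auto intro!: derivative_eq_intros simp: add_pos_pos)

lemma DERIV_logistic: "DERIV logistic y :> logistic y * (1 - logistic y)"
proof -
  have "1 + exp y > 0" by (simp add: add_pos_pos)
  then show ?thesis
  unfolding logistic_def[abs_def]
  by (auto intro!: derivative_eq_intros simp: divide_simps) (simp_all add: algebra_simps)
qed

definition profile :: "real \<Rightarrow> real \<Rightarrow> real" where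
  "profile q y = softplus y powr q"

definition profile' :: "real \<Rightarrow> real \<Rightarrow> real" where
  "profile' q y = q * softplus y powr (q - 1) * logistic y"

definition profile'' :: "real \<Rightarrow> real \<Rightarrow> real" where
  "profile'' q y = q * (q - 1) * softplus y powr (q - 2) * (logistic y)\<^sup>2
     + q * softplus y powr (q - 1) * (logistic y * (1 - logistic y))"

lemma profile_nonneg: "profile q y \<ge> 0"
  by (simp add: profile_def)

lemma profile_ge: "0 \<le> y \<Longrightarrow> 0 \<le> q \<Longrightarrow> y powr q \<le> profile q y"
  unfolding profile_def by (intro powr_mono2) (auto simp: softplus_ge)

lemma DERIV_profile: "DERIV (profile q) y :> profile' q y"
  unfolding profile_def[abs_def] profile'_def
  using softplus_pos[of y]
  by (auto intro!: derivative_eq_intros DERIV_softplus DERIV_powr simp: powr_diff)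

lemma DERIV_profile': "DERIV (profile' q) y :> profile'' q y"
proof -
  have "DERIV (\<lambda>y. softplus y powr (q - 1)) y :> (q - 1) * softplus y powr (q - 2) * logistic y"
    using DERIV_fun_powr[OF DERIV_softplus softplus_pos, of "q - 1"]
    by (simp add: algebra_simps)
  from DERIV_mult[OF DERIV_cmult[OF this, of q] DERIV_logistic[of y]]
  show ?thesis
    unfolding profile'_def[abs_def] profile''_def
    by (simp add: algebra_simps power2_eq_square)
qed

text \<open>Since \<open>logistic\<close> is at most 1 and at most \<open>softplus\<close>, both
  terms of \<open>profile''\<close> are controlled by \<open>softplus y powr q\<close>, and their
  coefficients add up to \<open>q * (q - 1) + q\<close>.\<close>

lemma profile''_le:
  assumes "q > 1"
  shows "profile'' q y \<le> q\<^sup>2 * profile q y"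
proof -
  note b = logistic_bounds[of y] softplus_pos[of y]
  have "softplus y powr (q - 2) * (logistic y)\<^sup>2 \<le> softplus y powr (q - 2) * (softplus y)\<^sup>2"
    using b by (intro mult_left_mono power_mono) auto
  also have "\<dots> = profile q y"
    using b by (simp add: profile_def powr_diff)
  finally have 1: "softplus y powr (q - 2) * (logistic y)\<^sup>2 \<le> profile q y" .
  have "logistic y * (1 - logistic y) \<le> softplus y"
    using b mult_left_le[of "1 - logistic y" "logistic y"] by linarith
  then have "softplus y powr (q - 1) * (logistic y * (1 - logistic y)) \<le> softplus y powr (q - 1) * softplus y"
    by (intro mult_left_mono) auto
  also have "\<dots> = profile q y"
    using b by (simp add: profile_def powr_diff)
  finally have 2: "softplus y powr (q - 1) * (logistic y * (1 - logistic y)) \<le> profile q y" .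
  have "profile'' q y \<le> q * (q - 1) * profile q y + q * profile q y"
    unfolding profile''_def using 1 2 assms
    by (intro add_mono) (simp_all add: mult.assoc mult_left_mono)
  then show ?thesis by (simp add: algebra_simps power2_eq_square)
qed

text \<open>Here the critical exponent enters: \<open>(q - 1) * p = q\<close> turns the power of the
  gradient back into the profile.\<close>

lemma profile'_powr_le:
  assumes "p > 1" "q = 1 / (p - 1) + 1"
  shows "\<bar>profile' q y\<bar> powr p \<le> q powr p * profile q y"
proof -
  note b = logistic_bounds[of y] softplus_pos[of y]
  have q: "q > 0" using assms by (simp add: add_pos_pos)
  have qp: "(q - 1) * p = q" using assms by (simp add: field_simps)
  have "\<bar>profile' q y\<bar> \<le> q * softplus y powr (q - 1)"
    unfolding profile'_def using b q by (simp add: abs_mult mult_left_le)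
  then have "\<bar>profile' q y\<bar> powr p \<le> (q * softplus y powr (q - 1)) powr p"
    using assms by (intro powr_mono2) auto
  also have "\<dots> = q powr p * profile q y"
    using b q qp by (simp add: powr_mult powr_powr profile_def)
  finally show ?thesis .
qed

text \<open>At minus infinity \<open>softplus\<close> decays to 0, so a profile shifted far to the
  right vanishes pointwise.\<close>

lemma profile_at_bot:
  assumes "q > 0"
  shows "(\<lambda>R. profile q (y - real R)) \<longlonglongrightarrow> 0"
proof -
  have "(\<lambda>R::nat. exp y * exp (-1) ^ R) \<longlonglongrightarrow> exp y * 0"
    by (intro tendsto_mult_left LIMSEQ_realpow_zero) auto
  moreover have "exp y * exp (-1) ^ R = exp (y - real R)" for R
    by (simp add: exp_of_nat_mult[symmetric] exp_add[symmetric])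
  ultimately have "(\<lambda>R::nat. exp (y - real R)) \<longlonglongrightarrow> 0" by simp
  then have "(\<lambda>R::nat. softplus (y - real R)) \<longlonglongrightarrow> ln (1 + 0)"
    unfolding softplus_def by (intro tendsto_ln tendsto_add tendsto_const) simp_all
  then have "(\<lambda>R::nat. softplus (y - real R)) \<longlonglongrightarrow> 0" by simp
  then show ?thesis
    unfolding profile_def using assms softplus_pos
    by (intro tendsto_eq_intros) (auto intro!: always_eventually simp: less_imp_le)
qed

section \<open>Classical derivatives and strict supersolutions\<close>

lemma has_dir_derivD:
  assumes "has_dir_deriv e f z"
  shows "DERIV (\<lambda>s. f (z + s *\<^sub>R e)) 0 :> dir_deriv e f z"
  using assms unfolding has_dir_deriv_def dir_deriv_def
  by (simp add: DERIV_deriv_iff_field_differentiable)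

lemma C21_time_deriv:
  assumes "u \<in> C21 Q" "z \<in> Q"
  shows "DERIV (\<lambda>s. u (z + s *\<^sub>R time_dir)) 0 :> time_deriv u z"
  unfolding time_deriv_def
  by (rule has_dir_derivD) (use assms in \<open>simp add: C21_def cont_dir_diff_on_def\<close>)

lemma C21_space_deriv:
  assumes "u \<in> C21 Q" "z \<in> Q"
  shows "DERIV (\<lambda>s. u (z + s *\<^sub>R space_dir i)) 0 :> dir_deriv (space_dir i) u z"
    and "DERIV (\<lambda>s. dir_deriv (space_dir i) u (z + s *\<^sub>R space_dir i)) 0
           :> dir_deriv (space_dir i) (dir_deriv (space_dir i) u) z"
  by (rule has_dir_derivD, use assms in \<open>simp add: C21_def cont_dir_diff_on_def\<close>)+

text \<open>First, second and time derivatives are carried as witnesses \<open>G\<close>,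
  \<open>L\<close>, \<open>D\<close>. They exist on all of space-time; only the strict inequality
  refers to the time slab.\<close>

definition strict_supersolution ::
    "real \<Rightarrow> real \<Rightarrow> real \<Rightarrow> ((real^'n::finite) \<times> real \<Rightarrow> real) \<Rightarrow> bool" where
  "strict_supersolution p a b \<Phi> \<longleftrightarrow> continuous_on UNIV \<Phi> \<and> (\<exists>G L D.
     (\<forall>z i. DERIV (\<lambda>s. \<Phi> (z + s *\<^sub>R space_dir i)) 0 :> G i z) \<and>
     (\<forall>z i. DERIV (\<lambda>s. G i (z + s *\<^sub>R space_dir i)) 0 :> L i z) \<and>
     (\<forall>z. DERIV (\<lambda>s. \<Phi> (z + s *\<^sub>R time_dir)) 0 :> D z) \<and>
     (\<forall>z. snd z \<in> {a..b} \<longrightarrow> norm (\<chi> i. G i z) powr p < D z - (\<Sum>i\<in>UNIV. L i z)))"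

text \<open>The linear terms average exactly, and the convexity of the gradient term has the sign
  that supersolutions need.\<close>

lemma strict_supersolution_convex_comb:
  fixes \<Phi> \<Psi> :: "(real^'n::finite) \<times> real \<Rightarrow> real"
  assumes "p > 1" "0 < m" "m < 1"
    and "strict_supersolution p a b \<Phi>" "strict_supersolution p a b \<Psi>"
  shows "strict_supersolution p a b (\<lambda>z. m * \<Phi> z + (1 - m) * \<Psi> z)"
proof -
  obtain G L D where 1: "continuous_on UNIV \<Phi>"
     "\<And>z i. DERIV (\<lambda>s. \<Phi> (z + s *\<^sub>R space_dir i)) 0 :> G i z"
     "\<And>z i. DERIV (\<lambda>s. G i (z + s *\<^sub>R space_dir i)) 0 :> L i z"
     "\<And>z. DERIV (\<lambda>s. \<Phi> (z + s *\<^sub>R time_dir)) 0 :> D z"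
     "\<And>z. snd z \<in> {a..b} \<Longrightarrow> norm (\<chi> i. G i z) powr p < D z - (\<Sum>i\<in>UNIV. L i z)"
    using assms(4) unfolding strict_supersolution_def by blast
  obtain G' L' D' where 2: "continuous_on UNIV \<Psi>"
     "\<And>z i. DERIV (\<lambda>s. \<Psi> (z + s *\<^sub>R space_dir i)) 0 :> G' i z"
     "\<And>z i. DERIV (\<lambda>s. G' i (z + s *\<^sub>R space_dir i)) 0 :> L' i z"
     "\<And>z. DERIV (\<lambda>s. \<Psi> (z + s *\<^sub>R time_dir)) 0 :> D' z"
     "\<And>z. snd z \<in> {a..b} \<Longrightarrow> norm (\<chi> i. G' i z) powr p < D' z - (\<Sum>i\<in>UNIV. L' i z)"
    using assms(5) unfolding strict_supersolution_def by blast
  have "norm (\<chi> i. m * G i z + (1 - m) * G' i z) powr p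
      < (m * D z + (1 - m) * D' z) - (\<Sum>i\<in>UNIV. m * L i z + (1 - m) * L' i z)"
    if "snd z \<in> {a..b}" for z
  proof -
    have "(\<chi> i. m * G i z + (1 - m) * G' i z) = m *\<^sub>R (\<chi> i. G i z) + (1 - m) *\<^sub>R (\<chi> i. G' i z)"
      by (simp add: vec_eq_iff)
    then have "norm (\<chi> i. m * G i z + (1 - m) * G' i z) powr p
      \<le> m * norm (\<chi> i. G i z) powr p + (1 - m) * norm (\<chi> i. G' i z) powr p"
      using norm_powr_convex[of p m "\<chi> i. G i z" "\<chi> i. G' i z"] assms(1-3) by simp
    also have "\<dots> < m * (D z - (\<Sum>i\<in>UNIV. L i z)) + (1 - m) * (D' z - (\<Sum>i\<in>UNIV. L' i z))"
      using 1(5)[OF that] 2(5)[OF that] assms(2,3) by (intro add_strict_mono mult_strict_left_mono) auto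
    also have "\<dots> = (m * D z + (1 - m) * D' z) - (\<Sum>i\<in>UNIV. m * L i z + (1 - m) * L' i z)"
      by (simp only: sum.distrib sum_distrib_left[symmetric]) (simp add: algebra_simps)
    finally show ?thesis .
  qed
  moreover have "continuous_on UNIV (\<lambda>z. m * \<Phi> z + (1 - m) * \<Psi> z)"
    by (intro continuous_intros 1 2)
  ultimately show ?thesis
    unfolding strict_supersolution_def
    by (intro conjI exI[of _ "\<lambda>i z. m * G i z + (1 - m) * G' i z"]
        exI[of _ "\<lambda>i z. m * L i z + (1 - m) * L' i z"] exI[of _ "\<lambda>z. m * D z + (1 - m) * D' z"]
        allI impI DERIV_add DERIV_cmult 1 2) auto
qed

lemma DERIV_along_axis:
  fixes z :: "(real^'n::finite) \<times> real"
  assumes "DERIV g (fst z $ j) :> d"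
  shows "DERIV (\<lambda>s. g (fst (z + s *\<^sub>R space_dir i) $ j)) 0 :> (if i = j then d else 0)"
proof (cases "i = j")
  case True
  then show ?thesis
    using assms DERIV_shift[of g d 0 "fst z $ j"] by (simp add: add.commute)
qed (simp add: axis_def)

lemma norm_vec_singleton:
  fixes k :: "'n::finite"
  shows "norm ((\<chi> i. if i = k then c else 0) :: real^'n) = \<bar>c\<bar>"
proof -
  have "((\<chi> i. if i = k then c else 0) :: real^'n) = c *\<^sub>R axis k 1"
    by (simp add: vec_eq_iff axis_def)
  then show ?thesis by simp
qed

text \<open>While the coefficient of the profile is at most \<open>2 * a\<close>, the first summand
  pays for the Laplacian and the second for the gradient term; the 1 makes the inequality
  strict.\<close>

definition growth_rate :: "real \<Rightarrow> real \<Rightarrow> real \<Rightarrow> real" where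
  "growth_rate p q a = 2 * a * q\<^sup>2 + q powr p * (2 * a) powr p + 1"

lemma growth_rate_pos: "a > 0 \<Longrightarrow> growth_rate p q a > 0"
  by (simp add: growth_rate_def add_nonneg_pos)

text \<open>Up to time \<open>\<sigma> + a / r\<close> the coefficient at most doubles, so its
  growth \<open>r\<close> pays for all other terms. The slab may start later than \<sigma>, as the
  iteration in time requires.\<close>

lemma strict_supersolution_profile:
  fixes k :: "'n::finite"
  assumes p: "p > 1" and q: "q = 1 / (p - 1) + 1" and a: "a > 0"
    and r: "r = growth_rate p q a" and s: "\<sigma> \<le> s" "s' \<le> \<sigma> + a / r"
  shows "strict_supersolution p s s' (\<lambda>z::(real^'n) \<times> real. (a + r * (snd z - \<sigma>)) * profile q (fst z $ k + c))"
proof -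
  let ?A = "\<lambda>z::(real^'n) \<times> real. a + r * (snd z - \<sigma>)"
  have q1: "q > 1" using p q by simp
  have rpos: "r > 0" using growth_rate_pos[OF a] r by simp
  have d1: "DERIV (\<lambda>y. profile q (y + c)) y :> profile' q (y + c)" for y
    using DERIV_shift DERIV_profile by blast
  have d2: "DERIV (\<lambda>y. profile' q (y + c)) y :> profile'' q (y + c)" for y
    using DERIV_shift DERIV_profile' by blast
  define G where "G = (\<lambda>i (z::(real^'n) \<times> real). if i = k then ?A z * profile' q (fst z $ k + c) else 0)"
  define L where "L = (\<lambda>i (z::(real^'n) \<times> real). if i = k then ?A z * profile'' q (fst z $ k + c) else 0)"
  have cont: "continuous_on UNIV (\<lambda>z::(real^'n) \<times> real. ?A z * profile q (fst z $ k + c))"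
  proof -
    have "continuous_on UNIV (profile q)"
      by (intro continuous_at_imp_continuous_on) (auto intro!: DERIV_isCont DERIV_profile)
    then have "continuous_on UNIV (\<lambda>z::(real^'n) \<times> real. profile q (fst z $ k + c))"
      by (rule continuous_on_compose2) (auto intro!: continuous_intros)
    then show ?thesis by (intro continuous_intros)
  qed
  have g: "DERIV (\<lambda>s. ?A (z + s *\<^sub>R space_dir i) * profile q (fst (z + s *\<^sub>R space_dir i) $ k + c)) 0 :> G i z"
    for z :: "(real^'n) \<times> real" and i
    using DERIV_cmult[OF DERIV_along_axis[OF d1, where z = z and j = k and i = i], of "?A z"]
    by (cases "i = k") (simp_all add: G_def)
  have l: "DERIV (\<lambda>s. G i (z + s *\<^sub>R space_dir i)) 0 :> L i z" for z i
    using DERIV_cmult[OF DERIV_along_axis[OF d2, where z = z and j = k and i = i], of "?A z"]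
    by (cases "i = k") (simp_all add: G_def L_def)
  have t: "DERIV (\<lambda>s. ?A (z + s *\<^sub>R time_dir) * profile q (fst (z + s *\<^sub>R time_dir) $ k + c)) 0
      :> r * profile q (fst z $ k + c)" for z :: "(real^'n) \<times> real"
    by (auto intro!: derivative_eq_intros)
  have "norm (\<chi> i. G i z) powr p < r * profile q (fst z $ k + c) - (\<Sum>i\<in>UNIV. L i z)"
    if "snd z \<in> {s..s'}" for z
  proof -
    let ?S = "profile q (fst z $ k + c)"
    have "r * (snd z - \<sigma>) \<le> r * (a / r)"
      using that s rpos by (intro mult_left_mono) auto
    then have A: "0 < ?A z" "?A z \<le> 2 * a"
      using that s rpos a by (auto simp: add_pos_nonneg)
    have "norm (\<chi> i. G i z) powr p = ?A z powr p * \<bar>profile' q (fst z $ k + c)\<bar> powr p"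
      unfolding G_def norm_vec_singleton using A by (simp add: abs_mult powr_mult)
    also have "\<dots> \<le> (2 * a) powr p * (q powr p * ?S)"
      using A p by (intro mult_mono powr_mono2 profile'_powr_le[OF p q]) auto
    finally have 1: "norm (\<chi> i. G i z) powr p \<le> q powr p * (2 * a) powr p * ?S" by (simp add: ac_simps)
    have "(\<Sum>i\<in>UNIV. L i z) = ?A z * profile'' q (fst z $ k + c)"
      by (simp add: L_def)
    also have "\<dots> \<le> ?A z * (q\<^sup>2 * ?S)"
      using A by (intro mult_left_mono profile''_le q1) auto
    also have "\<dots> \<le> 2 * a * (q\<^sup>2 * ?S)"
      using A by (intro mult_right_mono) (auto simp: profile_nonneg)
    finally have 2: "(\<Sum>i\<in>UNIV. L i z) \<le> 2 * a * q\<^sup>2 * ?S" by simp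
    have "?S > 0" using softplus_pos[of "fst z $ k + c"] by (simp add: profile_def)
    then show ?thesis using 1 2 unfolding r growth_rate_def by (simp add: algebra_simps)
  qed
  then show ?thesis
    unfolding strict_supersolution_def
    by (intro conjI exI[of _ G] exI[of _ L] exI[of _ "\<lambda>z. r * profile q (fst z $ k + c)"])
       (use cont g l t in auto)
qed

text \<open>The sum is a smooth substitute for the norm with first and second derivatives bounded by
  1, and it tends to infinity in all directions. The growth in time is the same multiple of
  \<epsilon> for every slope, so the barrier disappears as \<epsilon> tends to 0.\<close>

lemma strict_supersolution_cone:
  fixes p \<epsilon> s a b :: real
  assumes "p > 1" "0 < \<epsilon>" "\<epsilon> \<le> 1"
  defines "N \<equiv> real CARD('n::finite)"
  shows "strict_supersolution p a b (\<lambda>z::(real^'n) \<times> real.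
     \<epsilon> * ((\<Sum>j\<in>UNIV. sqrt (1 + (fst z $ j)\<^sup>2)) + (N + N powr p + 1) * (snd z - s)))"
proof -
  let ?C = "N + N powr p + 1"
  let ?h = "\<lambda>y::real. sqrt (1 + y\<^sup>2)"
  let ?h' = "\<lambda>y::real. y / sqrt (1 + y\<^sup>2)"
  let ?h'' = "\<lambda>y::real. 1 / ((1 + y\<^sup>2) * sqrt (1 + y\<^sup>2))"
  have pos: "1 + y\<^sup>2 > 0" for y :: real by (simp add: add_pos_nonneg)
  have d1: "DERIV ?h y :> ?h' y" for y
    using pos[of y] by (auto intro!: derivative_eq_intros simp: field_simps)
  have d2: "DERIV ?h' y :> ?h'' y" for y
  proof -
    let ?r = "sqrt (1 + y\<^sup>2)"
    have r: "?r > 0" "?r * ?r = 1 + y\<^sup>2" using pos[of y] by simp_all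
    have "x - y * (y / x) = (x * x - y\<^sup>2) / x" if "x > 0" for x :: real
      using that by (simp add: field_simps power2_eq_square)
    then have "?r - y * (y / ?r) = (?r * ?r - y\<^sup>2) / ?r"
      using r(1) .
    also have "\<dots> = 1 / ?r" unfolding r(2) by simp
    finally have "(1 * ?r - y * (y / ?r)) / (?r * ?r) = ?h'' y"
      unfolding r(2) by simp
    moreover have "DERIV ?h' y :> (1 * ?r - y * (y / ?r)) / (?r * ?r)"
      using r(1) by (intro DERIV_divide DERIV_ident d1) simp
    ultimately show ?thesis by simp
  qed
  have h'1: "\<bar>?h' y\<bar> \<le> 1" for y
  proof -
    have "\<bar>y\<bar> \<le> sqrt (1 + y\<^sup>2)" by (rule real_le_rsqrt) simp
    then show ?thesis using pos[of y] by (simp add: divide_le_eq)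
  qed
  have h''1: "?h'' y \<le> 1" for y
  proof -
    have "1 \<le> (1 + y\<^sup>2) * sqrt (1 + y\<^sup>2)"
      using mult_mono[of 1 "1 + y\<^sup>2" 1 "sqrt (1 + y\<^sup>2)"] by simp
    then show ?thesis by (simp add: divide_le_eq)
  qed
  define G where "G = (\<lambda>i (z::(real^'n) \<times> real). \<epsilon> * ?h' (fst z $ i))"
  define L where "L = (\<lambda>i (z::(real^'n) \<times> real). \<epsilon> * ?h'' (fst z $ i))"
  have g: "DERIV (\<lambda>r. \<epsilon> * ((\<Sum>j\<in>UNIV. ?h (fst (z + r *\<^sub>R space_dir i) $ j))
       + ?C * (snd (z + r *\<^sub>R space_dir i) - s))) 0 :> G i z" for z :: "(real^'n) \<times> real" and i
  proof -
    have "DERIV (\<lambda>r. \<Sum>j\<in>UNIV. ?h (fst (z + r *\<^sub>R space_dir i) $ j)) 0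
        :> (\<Sum>j\<in>UNIV. if i = j then ?h' (fst z $ j) else 0)"
      by (intro DERIV_sum DERIV_along_axis d1)
    from DERIV_cmult[OF DERIV_add[OF this DERIV_const[of "?C * (snd z - s)"]], of \<epsilon>]
    show ?thesis by (simp add: G_def)
  qed
  have l: "DERIV (\<lambda>r. G i (z + r *\<^sub>R space_dir i)) 0 :> L i z" for z i
    using DERIV_cmult[OF DERIV_along_axis[OF d2, where z = z and j = i and i = i], of \<epsilon>] by (simp add: G_def L_def)
  have t: "DERIV (\<lambda>r. \<epsilon> * ((\<Sum>j\<in>UNIV. ?h (fst (z + r *\<^sub>R time_dir) $ j))
       + ?C * (snd (z + r *\<^sub>R time_dir) - s))) 0 :> \<epsilon> * ?C" for z :: "(real^'n) \<times> real"
    by (auto intro!: derivative_eq_intros)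
  have ineq: "norm (\<chi> i. G i z) powr p < \<epsilon> * ?C - (\<Sum>i\<in>UNIV. L i z)" for z
  proof -
    have "norm (\<chi> i. G i z) \<le> (\<Sum>i\<in>UNIV. \<bar>G i z\<bar>)"
      using norm_le_l1_cart[of "\<chi> i. G i z"] by simp
    also have "\<dots> \<le> (\<Sum>i\<in>(UNIV::'n set). \<epsilon>)"
      using mult_left_mono[OF h'1, of \<epsilon>] assms(2) by (intro sum_mono) (simp add: G_def abs_mult)
    also have "\<dots> = \<epsilon> * N" by (simp add: N_def)
    finally have "norm (\<chi> i. G i z) powr p \<le> (\<epsilon> * N) powr p"
      using assms by (intro powr_mono2) auto
    also have "\<dots> = \<epsilon> powr p * N powr p"
      using assms(2) by (simp add: powr_mult N_def)
    \<comment> \<open>From \<open>\<epsilon> \<le> 1\<close> and \<open>p > 1\<close> the gradient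
      term is also at most linear in \<epsilon>.\<close>
    also have "\<dots> \<le> \<epsilon> * N powr p"
      using powr_mono'[of 1 p \<epsilon>] assms by (intro mult_right_mono) auto
    finally have 1: "norm (\<chi> i. G i z) powr p \<le> \<epsilon> * N powr p" .
    have "(\<Sum>i\<in>UNIV. L i z) \<le> (\<Sum>i\<in>(UNIV::'n set). \<epsilon>)"
      using h''1 assms(2) by (intro sum_mono) (simp only: L_def mult_left_le less_imp_le)
    also have "\<dots> = \<epsilon> * N" by (simp add: N_def)
    finally show ?thesis using 1 assms(2) by (simp add: algebra_simps)
  qed
  show ?thesis
    unfolding strict_supersolution_def
    by (intro conjI exI[of _ G] exI[of _ L] exI[of _ "\<lambda>z. \<epsilon> * ?C"])
       (use g l t ineq in \<open>auto intro!: continuous_intros\<close>)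
qed

section \<open>The comparison principle\<close>

lemma open_cylinder: "open (cylinder (k::'n::finite) T)"
  unfolding cylinder_def half_space_def
  by (intro open_Times open_halfspace_component_gt_cart) auto

text \<open>At a positive maximum of \<open>v - m u - (1 - m) \<Phi>\<close> the gradient of \<open>v\<close> is the convex
  combination of those of \<open>u\<close> and \<open>\<Phi>\<close>, so convexity of the nonlinearity contradicts the
  strict inequality satisfied by \<open>\<Phi>\<close>.\<close>

lemma comparison:
  fixes k :: "'n::finite" and u v \<Phi> :: "(real^'n) \<times> real \<Rightarrow> real"
  assumes p: "p > 1" and m: "0 < m" "m < 1" and s: "0 \<le> s" "s' < T"
    and u: "u \<in> C21 (cylinder k T)" "continuous_on ({x. 0 \<le> x $ k} \<times> {0..<T}) u"
      "\<And>z. z \<in> cylinder k T \<Longrightarrow> time_deriv u z - space_laplacian u z = norm (space_grad u z) powr p"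
    and v: "v \<in> C21 (cylinder k T)" "continuous_on ({x. 0 \<le> x $ k} \<times> {0..<T}) v"
      "\<And>z. z \<in> cylinder k T \<Longrightarrow> time_deriv v z - space_laplacian v z = norm (space_grad v z) powr p"
    and super: "strict_supersolution p s s' \<Phi>"
    and init: "\<And>x. 0 < x $ k \<Longrightarrow> v (x, s) - m * u (x, s) \<le> (1 - m) * \<Phi> (x, s)"
    and bdry: "\<And>x t. x $ k = 0 \<Longrightarrow> s \<le> t \<Longrightarrow> t \<le> s' \<Longrightarrow> v (x, t) - m * u (x, t) \<le> (1 - m) * \<Phi> (x, t)"
    and far: "\<And>x t. 0 < x $ k \<Longrightarrow> \<rho> \<le> norm x \<Longrightarrow> s \<le> t \<Longrightarrow> t \<le> s' \<Longrightarrow>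
        v (x, t) - m * u (x, t) \<le> (1 - m) * \<Phi> (x, t)"
    and x0: "0 < x0 $ k" "s \<le> t0" "t0 \<le> s'"
  shows "v (x0, t0) - m * u (x0, t0) \<le> (1 - m) * \<Phi> (x0, t0)"
proof (rule ccontr)
  define f where "f z = v z - m * u z - (1 - m) * \<Phi> z" for z
  assume "\<not> ?thesis"
  then have f0: "f (x0, t0) > 0" by (simp add: f_def)
  \<comment> \<open>The radius covers both \<open>x0\<close> and all points not handled by
    \<open>far\<close>; the closed half-space makes the set compact.\<close>
  define K where "K = ({x::real^'n. 0 \<le> x $ k} \<inter> cball 0 (max \<rho> (norm x0))) \<times> {s..s'}"
  have "compact K"
    unfolding K_def
    by (intro compact_Times closed_Int_compact closed_halfspace_component_ge_cart) auto
  moreover have K0: "(x0, t0) \<in> K" using x0 by (simp add: K_def)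
  moreover have "continuous_on K f"
  proof -
    have "K \<subseteq> {x. 0 \<le> x $ k} \<times> {0..<T}" using s by (auto simp: K_def)
    then show ?thesis
      unfolding f_def using super unfolding strict_supersolution_def
      by (intro continuous_intros)
         (auto intro: continuous_on_subset u(2) v(2))
  qed
  ultimately obtain z where z: "z \<in> K" "\<And>y. y \<in> K \<Longrightarrow> f y \<le> f z"
    using continuous_attains_sup[of K f] by blast
  obtain x t where xt: "z = (x, t)" by (cases z)
  have fz: "f z > 0" using z(2)[OF K0] f0 by simp
  have xk: "0 < x $ k"
  proof (rule ccontr)
    assume "\<not> 0 < x $ k"
    then have "x $ k = 0" using z(1) by (simp add: K_def xt)
    with bdry[of x t] fz z(1) show False by (simp add: K_def xt f_def)
  qed
  have "t \<noteq> s" using init[OF xk] fz by (auto simp: xt f_def)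
  then have t: "s < t" "t \<le> s'" using z(1) by (auto simp: K_def xt)
  have zQ: "z \<in> cylinder k T"
    using xk t s by (simp add: cylinder_def half_space_def xt)
  \<comment> \<open>Outside \<open>K\<close> the hypothesis \<open>far\<close> gives
    \<open>f y \<le> 0\<close>, while \<open>f z\<close> is positive.\<close>
  have max: "f y \<le> f z" if "y \<in> cylinder k T" "snd y \<in> {s..s'}" for y
  proof (cases "y \<in> K")
    case False
    then have "\<rho> \<le> norm (fst y)" "0 < fst y $ k"
      using that by (auto simp: K_def cylinder_def half_space_def mem_Times_iff)
    then show ?thesis
      using far[of "fst y" "snd y"] that fz by (simp add: f_def)
  qed (use z in auto)
  obtain G L D where \<Phi>: "\<And>z i. DERIV (\<lambda>s. \<Phi> (z + s *\<^sub>R space_dir i)) 0 :> G i z"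
     "\<And>z i. DERIV (\<lambda>s. G i (z + s *\<^sub>R space_dir i)) 0 :> L i z"
     "\<And>z. DERIV (\<lambda>s. \<Phi> (z + s *\<^sub>R time_dir)) 0 :> D z"
     "\<And>z. snd z \<in> {s..s'} \<Longrightarrow> norm (\<chi> i. G i z) powr p < D z - (\<Sum>i\<in>UNIV. L i z)"
    using super unfolding strict_supersolution_def by blast
  let ?d = "\<lambda>i. dir_deriv (space_dir i)"
  have d: "?d i v z - m * ?d i u z - (1 - m) * G i z = 0"
          "?d i (?d i v) z - m * ?d i (?d i u) z - (1 - m) * L i z \<le> 0" for i
  proof -
    have "DERIV (\<lambda>s. f (y + s *\<^sub>R space_dir i)) 0 :> ?d i v y - m * ?d i u y - (1 - m) * G i y"
      if "y \<in> cylinder k T" for y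
      unfolding f_def
      by (intro DERIV_diff DERIV_cmult C21_space_deriv(1)[OF _ that] u(1) v(1) \<Phi>)
    moreover have "DERIV (\<lambda>s. ?d i v (z + s *\<^sub>R space_dir i) - m * ?d i u (z + s *\<^sub>R space_dir i)
        - (1 - m) * G i (z + s *\<^sub>R space_dir i)) 0
        :> ?d i (?d i v) z - m * ?d i (?d i u) z - (1 - m) * L i z"
      by (intro DERIV_diff DERIV_cmult C21_space_deriv(2)[OF _ zQ] u(1) v(1) \<Phi>)
    moreover have "f (z + r *\<^sub>R space_dir i) \<le> f z" if "z + r *\<^sub>R space_dir i \<in> cylinder k T" for r
      using max[OF that] t by (simp add: xt)
    ultimately show "?d i v z - m * ?d i u z - (1 - m) * G i z = 0"
          "?d i (?d i v) z - m * ?d i (?d i u) z - (1 - m) * L i z \<le> 0"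
      using directional_max[OF open_cylinder zQ, of f "space_dir i"
          "\<lambda>y. ?d i v y - m * ?d i u y - (1 - m) * G i y"] by blast+
  qed
  have "space_grad v z = m *\<^sub>R space_grad u z + (1 - m) *\<^sub>R (\<chi> i. G i z)"
    using d(1) by (simp add: vec_eq_iff space_grad_def algebra_simps)
  then have "norm (space_grad v z) powr p
      \<le> m * norm (space_grad u z) powr p + (1 - m) * norm (\<chi> i. G i z) powr p"
    using norm_powr_convex[of p m "space_grad u z"] p m by simp
  also have "\<dots> < m * norm (space_grad u z) powr p + (1 - m) * (D z - (\<Sum>i\<in>UNIV. L i z))"
    using \<Phi>(4)[of z] t m by (simp add: xt)
  finally have grad: "norm (space_grad v z) powr p
      < m * norm (space_grad u z) powr p + (1 - m) * (D z - (\<Sum>i\<in>UNIV. L i z))" .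
  have "(\<Sum>i\<in>UNIV. ?d i (?d i v) z - m * ?d i (?d i u) z - (1 - m) * L i z) \<le> 0"
    using d(2) by (intro sum_nonpos) auto
  then have lap: "space_laplacian v z - m * space_laplacian u z - (1 - m) * (\<Sum>i\<in>UNIV. L i z) \<le> 0"
    by (simp add: space_laplacian_def sum_subtractf sum_distrib_left)
  have time: "time_deriv v z - m * time_deriv u z - (1 - m) * D z \<ge> 0"
  proof (rule deriv_nonneg_at_left_max)
    show "DERIV (\<lambda>r. f (z + r *\<^sub>R time_dir)) 0 :> time_deriv v z - m * time_deriv u z - (1 - m) * D z"
      unfolding f_def by (intro DERIV_diff DERIV_cmult C21_time_deriv[OF _ zQ] u(1) v(1) \<Phi>)
    show "t - s > 0" using t by simp
    show "f (z + (0 - h) *\<^sub>R time_dir) \<le> f (z + 0 *\<^sub>R time_dir)" if "0 < h" "h < t - s" for h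
      using max[of "(x, t - h)"] that s t xk by (simp add: xt cylinder_def half_space_def)
  qed
  \<comment> \<open>Subtracting \<open>m\<close> times the equation of \<open>u\<close> from that of
    \<open>v\<close> contradicts the signs of the derivatives of \<open>f\<close> at
    \<open>z\<close>.\<close>
  have "m * (time_deriv u z - space_laplacian u z) = m * norm (space_grad u z) powr p"
    using u(3)[OF zQ] by simp
  with grad lap time v(3)[OF zQ] show False by (simp add: algebra_simps)
qed

section \<open>Pointwise bounds from membership in the function spaces\<close>

text \<open>By continuity the set where \<open>v\<close> exceeds \<open>M * w\<close> is open; the
  essential bound makes it negligible, hence empty.\<close>

lemma Linf_weighted_bound:
  fixes v w :: "'a::euclidean_space \<Rightarrow> real"
  assumes "v \<in> Linf_weighted A w" "open A" "continuous_on A v" "continuous_on A w"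
    and w: "\<And>z. z \<in> A \<Longrightarrow> w z > 0"
  obtains M where "M > 0" "\<And>z. z \<in> A \<Longrightarrow> v z \<le> M * w z"
proof -
  let ?e = "esssup (lebesgue_on A) (\<lambda>z. ereal (v z / w z))"
  have "?e < \<infinity>" using assms(1) by (simp add: Linf_weighted_def)
  then obtain M0 where M0: "?e \<le> ereal M0" by (cases ?e) auto
  define M where "M = max 1 M0"
  have eM: "?e \<le> ereal M" using M0 by (rule order_trans) (simp add: M_def)
  have "AE z in lebesgue_on A. ereal (v z / w z) \<le> ?e" by (rule esssup_AE)
  then have "AE z in lebesgue_on A. v z / w z \<le> M"
  proof eventually_elim
    case (elim z)
    then have "ereal (v z / w z) \<le> ereal M" using eM by (rule order_trans)
    then show ?case by simp
  qed
  then have ae: "AE z in lebesgue. z \<in> A \<longrightarrow> v z / w z \<le> M"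
    using assms(2) by (subst (asm) AE_restrict_space_iff) auto
  define N where "N = A \<inter> (\<lambda>z. v z - M * w z) -` {0<..}"
  have "open N"
    unfolding N_def using assms(2-4) by (intro continuous_open_preimage continuous_intros) auto
  moreover have "AE z in lebesgue. z \<notin> N"
    using ae by (rule AE_mp) (use w in \<open>auto intro!: AE_I2 simp: N_def divide_le_eq\<close>)
  then have "negligible N"
    using \<open>open N\<close> by (simp add: negligible_iff_null_sets AE_iff_null_sets borel_open)
  ultimately have "N = {}" using open_not_negligible by blast
  then have "v z \<le> M * w z" if "z \<in> A" for z
    using that by (force simp: N_def)
  then show ?thesis by (intro that[of M]) (auto simp: M_def)
qed

text \<open>The classical information that the comparison uses. Sign, growth and zero boundary
  values include \<open>t = 0\<close>, where \<open>is_solution\<close> prescribes no boundary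
  value.\<close>

definition bounded_solution ::
    "'n::finite \<Rightarrow> real \<Rightarrow> real \<Rightarrow> real \<Rightarrow> ((real^'n) \<times> real \<Rightarrow> real) \<Rightarrow> bool" where
  "bounded_solution k p T M u \<longleftrightarrow>
     u \<in> C21 (cylinder k T) \<and>
     continuous_on ({x. 0 \<le> x $ k} \<times> {0..<T}) u \<and>
     (\<forall>z\<in>cylinder k T. time_deriv u z - space_laplacian u z = norm (space_grad u z) powr p) \<and>
     (\<forall>x t. x $ k = 0 \<longrightarrow> 0 \<le> t \<longrightarrow> t < T \<longrightarrow> u (x, t) = 0) \<and>
     (\<forall>x t. 0 \<le> x $ k \<longrightarrow> 0 \<le> t \<longrightarrow> t < T \<longrightarrow> 0 \<le> u (x, t) \<and> u (x, t) \<le> M * weight k p x)"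

lemma bounded_solutionD:
  assumes "bounded_solution k p T M u"
  shows "u \<in> C21 (cylinder k T)" "continuous_on ({x. 0 \<le> x $ k} \<times> {0..<T}) u"
    and "z \<in> cylinder k T \<Longrightarrow> time_deriv u z - space_laplacian u z = norm (space_grad u z) powr p"
    and "x $ k = 0 \<Longrightarrow> 0 \<le> t \<Longrightarrow> t < T \<Longrightarrow> u (x, t) = 0"
    and "0 \<le> x $ k \<Longrightarrow> 0 \<le> t \<Longrightarrow> t < T \<Longrightarrow> 0 \<le> u (x, t)"
    and "0 \<le> x $ k \<Longrightarrow> 0 \<le> t \<Longrightarrow> t < T \<Longrightarrow> u (x, t) \<le> M * (1 + x $ k) powr (1 / (p - 1) + 1)"
  using assms unfolding bounded_solution_def weight_def by blast+

lemma closure_cylinder: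
  assumes "T > 0"
  shows "closure (cylinder k T) = {x. 0 \<le> x $ k} \<times> {0..T}"
  using assms unfolding cylinder_def half_space_def closure_Times
  by (simp add: closure_greaterThanLessThan)

text \<open>Membership in \<open>Y_space\<close> gives continuity on the closed cylinder, so the
  interior growth bound passes to its boundary.\<close>

lemma bounded_solution_exists:
  fixes k :: "'n::finite" and u :: "(real^'n) \<times> real \<Rightarrow> real"
  assumes T: "T > 0" and Y: "u \<in> Y_space k p T" and sol: "is_solution k p T u0 u"
  obtains M where "M > 0" "bounded_solution k p T M u"
proof -
  let ?w = "\<lambda>(x, t). weight k p x"
  note cl = closure_cylinder[OF T, of k]
  have u: "continuous_on (closure (cylinder k T)) u" "\<And>z. z \<in> closure (cylinder k T) \<Longrightarrow> 0 \<le> u z"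
    "u \<in> Linf_weighted (cylinder k T) ?w" "u \<in> C21 (cylinder k T)"
    using Y by (auto simp: Y_space_def C0U_def)
  have cw: "continuous_on (closure (cylinder k T)) ?w"
    unfolding weight_def split_def
    by (intro continuous_intros) (auto simp: cl add_nonneg_eq_0_iff)
  obtain M where M: "M > 0" "\<And>z. z \<in> cylinder k T \<Longrightarrow> u z \<le> M * ?w z"
  proof (rule Linf_weighted_bound[OF u(3) open_cylinder])
    show "continuous_on (cylinder k T) u" "continuous_on (cylinder k T) ?w"
      using u(1) cw continuous_on_subset closure_subset by blast+
    show "?w z > 0" if "z \<in> cylinder k T" for z
      using that by (auto simp: cylinder_def half_space_def weight_def)
  qed auto
  have bound: "u z \<le> M * ?w z" if "z \<in> closure (cylinder k T)" for z
  proof -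
    have cont: "continuous_on (closure (cylinder k T)) (\<lambda>z. u z - M * ?w z)"
      by (intro continuous_on_diff continuous_on_mult continuous_on_const u(1) cw)
    have le: "u y - M * ?w y \<le> 0" if "y \<in> cylinder k T" for y
      using M(2)[OF that] by (simp only: diff_le_0_iff_le)
    have "u z - M * ?w z \<le> 0"
      by (rule continuous_le_on_closure[OF cont that le])
    then show ?thesis by simp
  qed
  have bdry: "u (x, t) = 0" if "x $ k = 0" "0 \<le> t" "t < T" for x t
  proof -
    have "x \<in> frontier (half_space k)"
      using that(1) open_halfspace_component_gt_cart[of 0 k]
      by (simp add: frontier_def half_space_def interior_open)
    \<comment> \<open>The boundary condition holds for positive times; continuity along the vertical
      segment adds \<open>t = 0\<close>.\<close>
    then have "u z = 0" if "z \<in> {x} \<times> {0<..<T}" for z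
      using sol that by (auto simp: is_solution_def)
    moreover have "closure ({x} \<times> {0<..<T}) = {x} \<times> {0..T}"
      using T by (simp add: closure_Times closure_greaterThanLessThan)
    moreover have "continuous_on ({x} \<times> {0..T}) u"
      by (rule continuous_on_subset[OF u(1)]) (use that in \<open>auto simp: cl\<close>)
    ultimately show ?thesis
      using continuous_constant_on_closure[of "{x} \<times> {0<..<T}" u 0 "(x, t)"] that by auto
  qed
  have "continuous_on ({x. 0 \<le> x $ k} \<times> {0..<T}) u"
    by (rule continuous_on_subset[OF u(1)]) (auto simp: cl)
  moreover have "time_deriv u z - space_laplacian u z = norm (space_grad u z) powr p"
    if "z \<in> cylinder k T" for z
  proof -
    have "fst z \<in> half_space k" "snd z \<in> {0<..<T}"
      using that by (simp_all only: cylinder_def mem_Times_iff)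
    then have "time_deriv u (fst z, snd z) - space_laplacian u (fst z, snd z)
        = norm (space_grad u (fst z, snd z)) powr p"
      using sol unfolding is_solution_def by blast
    then show ?thesis by simp
  qed
  moreover have "0 \<le> u (x, t) \<and> u (x, t) \<le> M * weight k p x" if "0 \<le> x $ k" "0 \<le> t" "t < T" for x t
    using u(2)[of "(x, t)"] bound[of "(x, t)"] that by (simp add: cl)
  ultimately have "bounded_solution k p T M u"
    using u(4) bdry unfolding bounded_solution_def by blast
  with M(1) show ?thesis by (rule that)
qed

lemma bounded_solution_mono:
  assumes "bounded_solution k p T M u" "M \<le> M'"
  shows "bounded_solution k p T M' u"
proof -
  have le: "u (x, t) \<le> M' * weight k p x" if "0 \<le> x $ k" "0 \<le> t" "t < T" for x t
  proof -
    have "u (x, t) \<le> M * weight k p x"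
      using bounded_solutionD(6)[OF assms(1) that] by (simp add: weight_def)
    also have "\<dots> \<le> M' * weight k p x"
      using assms(2) by (intro mult_right_mono) (auto simp: weight_def)
    finally show ?thesis .
  qed
  then show ?thesis
    using bounded_solutionD(1-5)[OF assms(1)] unfolding bounded_solution_def by blast
qed

section \<open>Propagation of a bound uniform in \<open>m\<close>\<close>

text \<open>The bound by \<open>\<phi>\<close> propagates over a time step whose length depends on \<open>m\<close> but neither on
  \<open>s\<close> nor on the initial data: a profile shifted far to the right dominates \<open>v\<close> for large
  \<open>x $ k\<close>, a cone of small slope does so for large tangential coordinates, and both
  contributions vanish in the limit.\<close>

lemma bound_propagates:
  fixes k :: "'n::finite" and u v :: "(real^'n) \<times> real \<Rightarrow> real"
  assumes p: "p > 1" and q: "q = 1 / (p - 1) + 1" and M: "M > 0" and m: "0 < m" "m < 1"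
    and u: "bounded_solution k p T M u" and v: "bounded_solution k p T M v"
    and a: "a > 0" and r: "r = growth_rate p q a"
    and b: "b = 4 * 2 powr q * M / (1 - m)" and r': "r' = growth_rate p q b"
    and t: "0 \<le> \<sigma>" "\<sigma> \<le> s" "s \<le> t" "t \<le> \<sigma> + a / r" "t \<le> s + b / r'" "t < T"
  defines "\<phi> \<equiv> \<lambda>z::(real^'n) \<times> real. (a + r * (snd z - \<sigma>)) * profile q (fst z $ k + 1)"
  assumes start: "\<And>x. 0 < x $ k \<Longrightarrow> v (x, s) - m * u (x, s) \<le> (1 - m) * (\<phi> (x, s) / 2)"
    and x: "0 < x $ k"
  shows "v (x, t) - m * u (x, t) \<le> (1 - m) * (\<phi> (x, t) / 2)"
proof -
  have q1: "q > 1" using p q by simp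
  have bpos: "b > 0" using M m by (simp add: b)
  have rpos: "r > 0" "r' > 0" using growth_rate_pos a bpos r r' by auto
  let ?N = "real CARD('n)"
  define C where "C = ?N + ?N powr p + 1"
  have C: "C > 0" by (simp add: C_def add_nonneg_pos)
  \<comment> \<open>The coefficient restarts from \<open>b\<close> at time \<open>s\<close>, and
    \<open>b\<close> is the same for all shifts \<open>R\<close>.\<close>
  define \<psi> where "\<psi> R z = (b + r' * (snd z - s)) * profile q (fst z $ k + - real R)"
    for R and z :: "(real^'n) \<times> real"
  define c where "c z = (\<Sum>j\<in>UNIV. sqrt (1 + (fst z $ j)\<^sup>2)) + C * (snd z - s)" for z :: "(real^'n) \<times> real"
  \<comment> \<open>The nested combination gives \<phi> the weight 1/2 and the two auxiliary
    barriers 1/4 each. This is the origin of the factor 1/2 in the propagated bound.\<close>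
  define \<Phi> where "\<Phi> R \<epsilon> z = 1/2 * \<phi> z + (1 - 1/2) * (1/2 * \<psi> R z + (1 - 1/2) * (\<epsilon> * c z))"
    for R \<epsilon> z
  have nonneg: "\<phi> z \<ge> 0" "\<psi> R z \<ge> 0" "c z \<ge> 0" if "s \<le> snd z" for R z
  proof -
    have "0 \<le> r * (snd z - \<sigma>)" "0 \<le> r' * (snd z - s)" "0 \<le> C * (snd z - s)"
      using that t rpos C by simp_all
    moreover have "0 \<le> (\<Sum>j\<in>UNIV. sqrt (1 + (fst z $ j)\<^sup>2))"
      by (intro sum_nonneg) simp
    ultimately show "\<phi> z \<ge> 0" "\<psi> R z \<ge> 0" "c z \<ge> 0"
      using a bpos by (simp_all add: \<phi>_def \<psi>_def c_def profile_nonneg)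
  qed
  have vle: "v (y, \<tau>) - m * u (y, \<tau>) \<le> M * (1 + y $ k) powr q"
    if "0 \<le> y $ k" "s \<le> \<tau>" "\<tau> \<le> t" for y \<tau>
  proof -
    have "0 \<le> \<tau>" "\<tau> < T" using that t(1,2,3,6) by linarith+
    then have "0 \<le> u (y, \<tau>)" "v (y, \<tau>) \<le> M * (1 + y $ k) powr q"
      using bounded_solutionD(5)[OF u that(1)] bounded_solutionD(6)[OF v that(1)] by (simp_all only: q)
    then show ?thesis using mult_nonneg_nonneg[of m "u (y, \<tau>)"] m by linarith
  qed
  have le: "v (x, t) - m * u (x, t) \<le> (1 - m) * \<Phi> R \<epsilon> (x, t)" if \<epsilon>: "0 < \<epsilon>" "\<epsilon> \<le> 1" for R \<epsilon>
  proof -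
    \<comment> \<open>Chosen so that \<open>(1 - m) * (\<epsilon> * \<rho> / 4)\<close> equals the
      growth bound at \<open>y $ k = 1 + 2 * real R\<close>.\<close>
    define \<rho> where "\<rho> = 4 * M * (2 + 2 * real R) powr q / ((1 - m) * \<epsilon>)"
    have super: "strict_supersolution p s t (\<Phi> R \<epsilon>)"
      unfolding \<Phi>_def
    proof (intro strict_supersolution_convex_comb)
      show "strict_supersolution p s t \<phi>"
        unfolding \<phi>_def by (rule strict_supersolution_profile[OF p q a r t(2,4)])
      show "strict_supersolution p s t (\<psi> R)"
        unfolding \<psi>_def[abs_def] by (rule strict_supersolution_profile[OF p q bpos r' order_refl t(5)])
      show "strict_supersolution p s t (\<lambda>z. \<epsilon> * c z)"
        unfolding c_def C_def by (rule strict_supersolution_cone[OF p \<epsilon>])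
    qed (use p in auto)
    have ge: "(1 - m) * (\<phi> z / 2) \<le> (1 - m) * \<Phi> R \<epsilon> z" "(1 - m) * (\<psi> R z / 4) \<le> (1 - m) * \<Phi> R \<epsilon> z"
      "(1 - m) * (\<epsilon> * c z / 4) \<le> (1 - m) * \<Phi> R \<epsilon> z" if "s \<le> snd z" for z
    proof -
      have "0 \<le> \<epsilon> * c z" using nonneg(3)[OF that] \<epsilon> by simp
      moreover have "\<Phi> R \<epsilon> z = \<phi> z / 2 + \<psi> R z / 4 + \<epsilon> * c z / 4"
        by (simp add: \<Phi>_def)
      ultimately have "\<phi> z / 2 \<le> \<Phi> R \<epsilon> z" "\<psi> R z / 4 \<le> \<Phi> R \<epsilon> z" "\<epsilon> * c z / 4 \<le> \<Phi> R \<epsilon> z"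
        using nonneg(1)[OF that] nonneg(2)[OF that, of R] by linarith+
      then show "(1 - m) * (\<phi> z / 2) \<le> (1 - m) * \<Phi> R \<epsilon> z" "(1 - m) * (\<psi> R z / 4) \<le> (1 - m) * \<Phi> R \<epsilon> z"
        "(1 - m) * (\<epsilon> * c z / 4) \<le> (1 - m) * \<Phi> R \<epsilon> z"
        using m by (intro mult_left_mono; linarith)+
    qed
    show ?thesis
    proof (rule comparison[OF p m _ t(6)])
      show "0 \<le> s" using t(1,2) by simp
      show "u \<in> C21 (cylinder k T)" "continuous_on ({x. 0 \<le> x $ k} \<times> {0..<T}) u"
        "v \<in> C21 (cylinder k T)" "continuous_on ({x. 0 \<le> x $ k} \<times> {0..<T}) v"
        using bounded_solutionD(1,2)[OF u] bounded_solutionD(1,2)[OF v] .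
      show "time_deriv u z - space_laplacian u z = norm (space_grad u z) powr p"
        "time_deriv v z - space_laplacian v z = norm (space_grad v z) powr p"
        if "z \<in> cylinder k T" for z
        using bounded_solutionD(3)[OF u that] bounded_solutionD(3)[OF v that] .
      show "strict_supersolution p s t (\<Phi> R \<epsilon>)" by (rule super)
      show "v (y, s) - m * u (y, s) \<le> (1 - m) * \<Phi> R \<epsilon> (y, s)" if "0 < y $ k" for y
        using start[OF that] ge(1)[of "(y, s)"] by simp
      show "v (y, \<tau>) - m * u (y, \<tau>) \<le> (1 - m) * \<Phi> R \<epsilon> (y, \<tau>)" if "y $ k = 0" "s \<le> \<tau>" "\<tau> \<le> t" for y \<tau>
      proof -
        have \<tau>: "0 \<le> \<tau>" "\<tau> < T" using that(2,3) t(1,2,6) by linarith+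
        have "0 \<le> (1 - m) * (\<phi> (y, \<tau>) / 2)"
          using nonneg(1)[of "(y, \<tau>)"] that(2) m(2) by simp
        also have "\<dots> \<le> (1 - m) * \<Phi> R \<epsilon> (y, \<tau>)"
          using ge(1)[of "(y, \<tau>)"] that(2) by simp
        finally show ?thesis
          using bounded_solutionD(4)[OF u that(1) \<tau>] bounded_solutionD(4)[OF v that(1) \<tau>]
          by simp
      qed
      show "v (y, \<tau>) - m * u (y, \<tau>) \<le> (1 - m) * \<Phi> R \<epsilon> (y, \<tau>)"
        if y: "0 < y $ k" "\<rho> \<le> norm y" and \<tau>: "s \<le> \<tau>" "\<tau> \<le> t" for y \<tau>
      \<comment> \<open>For large \<open>y $ k\<close> one has
        \<open>(1 + y $ k) / 2 \<le> y $ k - real R\<close>, and the shifted profile wins because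
        \<open>(1 - m) * b / 4 = 2 powr q * M\<close>. Otherwise \<open>y $ k\<close> is bounded and
        the cone wins.\<close>
      proof (cases "1 + 2 * real R \<le> y $ k")
        case True
        have "(2 * ((1 + y $ k) / 2)) powr q = 2 powr q * ((1 + y $ k) / 2) powr q"
          by (rule powr_mult)
        then have "(1 + y $ k) powr q = 2 powr q * ((1 + y $ k) / 2) powr q"
          by (simp only: nonzero_mult_div_cancel_left times_divide_eq_right)
        also have "((1 + y $ k) / 2) powr q \<le> (y $ k - real R) powr q"
          using True y(1) q1 by (intro powr_mono2) auto
        also have "\<dots> \<le> profile q (y $ k - real R)"
          using True q1 by (intro profile_ge) auto
        finally have "M * (1 + y $ k) powr q \<le> M * (2 powr q * profile q (y $ k - real R))"
          using M by (simp add: mult_left_mono)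
        also have "\<dots> = (1 - m) * (b * profile q (y $ k - real R) / 4)"
        proof -
          have "(1 - m) * b = 4 * 2 powr q * M" using m(2) by (simp add: b)
          then show ?thesis
            by (metis (no_types, opaque_lifting) mult.assoc mult.commute nonzero_mult_div_cancel_left
                times_divide_eq_right zero_neq_numeral)
        qed
        also have "\<dots> \<le> (1 - m) * (\<psi> R (y, \<tau>) / 4)"
          unfolding \<psi>_def using m \<tau> rpos
          by (intro mult_left_mono divide_right_mono) (simp_all add: mult_right_mono profile_nonneg)
        finally have "M * (1 + y $ k) powr q \<le> (1 - m) * (\<psi> R (y, \<tau>) / 4)" .
        then show ?thesis
          by (rule order_trans[OF vle[OF less_imp_le[OF y(1)] \<tau>] order_trans[OF _ ge(2)]])
             (simp add: \<tau>)
      next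
        case False
        have "norm y \<le> (\<Sum>j\<in>UNIV. \<bar>y $ j\<bar>)" by (rule norm_le_l1_cart)
        also have "\<dots> \<le> (\<Sum>j\<in>UNIV. sqrt (1 + (y $ j)\<^sup>2))"
          by (intro sum_mono real_le_rsqrt) simp
        also have "\<dots> \<le> c (y, \<tau>)" using C \<tau> by (simp add: c_def)
        finally have "\<rho> \<le> c (y, \<tau>)" using y by simp
        have "M * (1 + y $ k) powr q \<le> M * (2 + 2 * real R) powr q"
          using M False y(1) q1 by (intro mult_left_mono powr_mono2) auto
        also have "\<dots> = (1 - m) * (\<epsilon> * \<rho> / 4)"
        proof -
          have "y = d * (\<epsilon> * (4 * y / (d * \<epsilon>)) / 4)" if "d > 0" for y d
            using that \<epsilon> by simp
          from this[of "1 - m"] show ?thesis using m(2) by (simp only: \<rho>_def mult.assoc diff_gt_0_iff_gt)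
        qed
        also have "\<dots> \<le> (1 - m) * (\<epsilon> * c (y, \<tau>) / 4)"
          using m \<epsilon> \<open>\<rho> \<le> c (y, \<tau>)\<close> by (intro mult_left_mono divide_right_mono) auto
        finally have "M * (1 + y $ k) powr q \<le> (1 - m) * (\<epsilon> * c (y, \<tau>) / 4)" .
        then show ?thesis
          by (rule order_trans[OF vle[OF less_imp_le[OF y(1)] \<tau>] order_trans[OF _ ge(3)]])
             (simp add: \<tau>)
      qed
    qed (use x t(3) in auto)
  qed
  \<comment> \<open>The shift tends to infinity and the slope to 0 along the same sequence; only
    half of \<phi> survives.\<close>
  have "(\<lambda>n. \<psi> n (x, t)) \<longlonglongrightarrow> (b + r' * (t - s)) * 0"
    unfolding \<psi>_def using profile_at_bot[of q "x $ k"] q1 by (intro tendsto_intros) auto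
  moreover have "(\<lambda>n. inverse (real (Suc n))) \<longlonglongrightarrow> 0"
    by (rule LIMSEQ_inverse_real_of_nat)
  ultimately have "(\<lambda>n. (1 - m) * \<Phi> n (inverse (real (Suc n))) (x, t)) \<longlonglongrightarrow>
      (1 - m) * (1/2 * \<phi> (x, t) + (1 - 1/2) * (1/2 * ((b + r' * (t - s)) * 0) + (1 - 1/2) * (0 * c (x, t))))"
    unfolding \<Phi>_def by (intro tendsto_intros)
  then have "v (x, t) - m * u (x, t) \<le>
      (1 - m) * (1/2 * \<phi> (x, t) + (1 - 1/2) * (1/2 * ((b + r' * (t - s)) * 0) + (1 - 1/2) * (0 * c (x, t))))"
    by (rule LIMSEQ_le_const) (use le in \<open>auto simp: inverse_le_1_iff\<close>)
  then show ?thesis by simp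
qed

text \<open>The barrier \<phi> and its time window depend on \<open>M\<close>, \<open>p\<close> and
  \<open>q\<close> but not on \<open>m\<close>. In the resulting bound the factor
  \<open>1 - m\<close> vanishes as \<open>m\<close> tends to 1.\<close>

lemma ordered_for_short_time:
  fixes k :: "'n::finite" and u v :: "(real^'n) \<times> real \<Rightarrow> real"
  assumes p: "p > 1" and q: "q = 1 / (p - 1) + 1" and M: "M > 0"
    and u: "bounded_solution k p T M u" and v: "bounded_solution k p T M v"
    and t: "0 \<le> \<sigma>" "\<sigma> \<le> t" "t \<le> \<sigma> + 2 * M / growth_rate p q (2 * M)" "t < T"
    and eq: "\<And>x. 0 < x $ k \<Longrightarrow> u (x, \<sigma>) = v (x, \<sigma>)"
    and x: "0 < x $ k"
  shows "v (x, t) \<le> u (x, t)"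
proof -
  define r where "r = growth_rate p q (2 * M)"
  define \<phi> where "\<phi> z = (2 * M + r * (snd z - \<sigma>)) * profile q (fst z $ k + 1)" for z :: "(real^'n) \<times> real"
  have q1: "q > 1" using p q by simp
  have bound: "v (x, t) - m * u (x, t) \<le> (1 - m) * (\<phi> (x, t) / 2)" if m: "0 < m" "m < 1" for m
  proof -
    define b where "b = 4 * 2 powr q * M / (1 - m)"
    have bpos: "b > 0" using M m by (simp add: b_def)
    let ?P = "\<lambda>s. \<forall>x. 0 < x $ k \<longrightarrow> v (x, s) - m * u (x, s) \<le> (1 - m) * (\<phi> (x, s) / 2)"
    have "?P t"
    proof (rule time_stepping[of "b / growth_rate p q b" ?P \<sigma> t])
      show "b / growth_rate p q b > 0" using bpos growth_rate_pos by simp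
      show "?P \<sigma>"
      proof (intro allI impI)
        fix y :: "real^'n"
        assume y: "0 < y $ k"
        have "v (y, \<sigma>) \<le> M * (1 + y $ k) powr q"
          using bounded_solutionD(6)[OF v] y t unfolding q by simp
        \<comment> \<open>The shift by 1 matches the weight, and the initial coefficient
          \<open>2 * M\<close> compensates for the half of \<phi>.\<close>
        also have "\<dots> \<le> M * profile q (y $ k + 1)"
          using M profile_ge[of "y $ k + 1" q] y q1 by (simp add: add.commute)
        finally have "v (y, \<sigma>) \<le> \<phi> (y, \<sigma>) / 2" by (simp add: \<phi>_def)
        then have "(1 - m) * v (y, \<sigma>) \<le> (1 - m) * (\<phi> (y, \<sigma>) / 2)"
          using m by (intro mult_left_mono) auto
        then show "v (y, \<sigma>) - m * u (y, \<sigma>) \<le> (1 - m) * (\<phi> (y, \<sigma>) / 2)"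
          using eq[OF y] by (simp add: algebra_simps)
      qed
      show "?P s'" if "\<sigma> \<le> s" "s \<le> s'" "s' \<le> t" "s' \<le> s + b / growth_rate p q b" "?P s" for s s'
      proof (intro allI impI)
        fix y :: "real^'n"
        assume "0 < y $ k"
        then show "v (y, s') - m * u (y, s') \<le> (1 - m) * (\<phi> (y, s') / 2)"
          unfolding \<phi>_def
          by (intro bound_propagates[OF p q M m u v _ r_def b_def refl t(1) that(1,2)])
             (use that t M in \<open>auto simp: \<phi>_def r_def\<close>)
      qed
    qed (use t in auto)
    with x show ?thesis by blast
  qed
  \<comment> \<open>These are the values of \<open>1 - m\<close>; the double \<open>Suc\<close>
    keeps \<open>m\<close> positive already for \<open>n = 0\<close>.\<close>
  have lim: "(\<lambda>n. inverse (real (Suc (Suc n)))) \<longlonglongrightarrow> 0"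
    by (rule LIMSEQ_Suc[OF LIMSEQ_inverse_real_of_nat])
  have "v (x, t) - (1 - 0) * u (x, t) \<le> 0 * (\<phi> (x, t) / 2)"
  proof (rule LIMSEQ_le)
    show "(\<lambda>n. v (x, t) - (1 - inverse (real (Suc (Suc n)))) * u (x, t)) \<longlonglongrightarrow> v (x, t) - (1 - 0) * u (x, t)"
      "(\<lambda>n. inverse (real (Suc (Suc n))) * (\<phi> (x, t) / 2)) \<longlonglongrightarrow> 0 * (\<phi> (x, t) / 2)"
      by (intro tendsto_intros lim)+
    have "v (x, t) - (1 - inverse (real (Suc (Suc n)))) * u (x, t) \<le> inverse (real (Suc (Suc n))) * (\<phi> (x, t) / 2)" for n
      using bound[of "1 - inverse (real (Suc (Suc n)))"] by (simp add: field_simps)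
    then show "\<exists>N. \<forall>n\<ge>N. v (x, t) - (1 - inverse (real (Suc (Suc n)))) * u (x, t)
        \<le> inverse (real (Suc (Suc n))) * (\<phi> (x, t) / 2)"
      by blast
  qed
  then show ?thesis by simp
qed

section \<open>Uniqueness on the whole cylinder\<close>

theorem proposition2p1:
  fixes k :: "'n::finite" and p T :: real
    and u0 :: "real^'n \<Rightarrow> real" and u v :: "(real^'n) \<times> real \<Rightarrow> real"
  assumes "p > 1" and "u0 \<in> X_space k p" and "T > 0"
    and "u \<in> Y_space k p T" and "is_solution k p T u0 u"
    and "v \<in> Y_space k p T" and "is_solution k p T u0 v"
  shows "\<forall>z\<in>closure (cylinder k T). u z = v z"
proof
  define q where "q = 1 / (p - 1) + 1"
  obtain M1 M2 where M12: "M1 > 0" "bounded_solution k p T M1 u" "M2 > 0" "bounded_solution k p T M2 v"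
    using bounded_solution_exists assms by metis
  define M where "M = max M1 M2"
  have M: "M > 0" "bounded_solution k p T M u" "bounded_solution k p T M v"
    using M12 by (auto simp: M_def intro: bounded_solution_mono)
  let ?\<tau> = "2 * M / growth_rate p q (2 * M)"
  have eq: "u (x, t) = v (x, t)" if x: "0 < x $ k" and t: "0 < t" "t < T" for x t
  proof -
    have "\<forall>x. 0 < x $ k \<longrightarrow> u (x, t) = v (x, t)"
    \<comment> \<open>The step depends only on \<open>p\<close>, \<open>q\<close> and the common
      bound \<open>M\<close>, so it can be repeated up to any \<open>t < T\<close>; the two
      solutions exchange roles for the opposite inequality.\<close>
    proof (rule time_stepping[where P = "\<lambda>s. \<forall>x. 0 < x $ k \<longrightarrow> u (x, s) = v (x, s)" and \<tau> = ?\<tau> and a = 0])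
      show "?\<tau> > 0" using M growth_rate_pos by simp
      show "\<forall>x. 0 < x $ k \<longrightarrow> u (x, 0) = v (x, 0)"
        using assms by (simp add: is_solution_def half_space_def)
      show "\<forall>x. 0 < x $ k \<longrightarrow> u (x, s') = v (x, s')"
        if s: "0 \<le> s" "s \<le> s'" "s' \<le> t" "s' \<le> s + ?\<tau>" and eqs: "\<forall>x. 0 < x $ k \<longrightarrow> u (x, s) = v (x, s)" for s s'
      proof (intro allI impI antisym)
        fix y :: "real^'n"
        assume y: "0 < y $ k"
        have "s' < T" using s t by simp
        show "v (y, s') \<le> u (y, s')"
          by (rule ordered_for_short_time[OF assms(1) q_def M s(1,2,4) \<open>s' < T\<close> _ y]) (use eqs in simp)
        show "u (y, s') \<le> v (y, s')"
          by (rule ordered_for_short_time[OF assms(1) q_def M(1,3,2) s(1,2,4) \<open>s' < T\<close> _ y]) (use eqs in simp)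
      qed
    qed (use t in auto)
    with x show ?thesis by blast
  qed
  fix z
  assume z: "z \<in> closure (cylinder k T)"
  have "continuous_on (closure (cylinder k T)) (\<lambda>z. u z - v z)"
    using assms by (intro continuous_intros) (auto simp: Y_space_def C0U_def)
  then have "u z - v z = 0"
    \<comment> \<open>Equality inside the cylinder extends by continuity to its closure, including
      \<open>t = T\<close>.\<close>
    by (rule continuous_constant_on_closure[OF _ _ z]) (auto simp: cylinder_def half_space_def eq)
  then show "u z = v z" by simp
qed

end
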